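(* A topological space is quasi-Polish if and only if it is a $T_0$ convergent approximation space having a countable basis.
   Context: Quasi-Polish: a topological space with a countable basis whose topology is induced by a complete quasi-metric, where a quasi-metric on $E$ is $d:E^2\to[0,+\infty)$ with $x=y\iff d(x,y)=d(y,x)=0$ and $d(x,z)\le d(x,y)+d(y,z)$ (topology generated by open balls $\{y:d(x,y)<r\}$), and completeness means every sequence with $\lim_n\sup_{p\ge n}d(x_n,x_p)=0$ converges for the metric $\max(d(x,y),d(y,x))$. Convergent approximation relation: a binary relation $\ll$ on a topological basis $\mathcal{B}$ such that for all $U,V,T\in\mathcal{B}$: (1) $U\ll V\Rightarrow V\subseteq U$; (2) $U\subseteq T$ and $U\ll V$ imply $T\ll V$; (3) for every $x\in U$ there is $W\in\mathcal{B}$ with $x\in W$, $U\ll W$; (4$^+$) every sequence $(U_i)$ in $\mathcal{B}$ with $U_i\ll U_{i+1}$ for all $i$ is a neighborhood basis of some point $x\in\bigcap_i U_i$. A convergent approximation space is a space admitting such a relation. *)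

theory Defs
  imports "HOL-Analysis.Analysis"
begin

definition quasi_metric_on :: "'a set \<Rightarrow> ('a \<Rightarrow> 'a \<Rightarrow> real) \<Rightarrow> bool" where
  "quasi_metric_on E d \<longleftrightarrow>
     (\<forall>x\<in>E. \<forall>y\<in>E. d x y \<ge> 0) \<and>
     (\<forall>x\<in>E. \<forall>y\<in>E. x = y \<longleftrightarrow> d x y = 0 \<and> d y x = 0) \<and>
     (\<forall>x\<in>E. \<forall>y\<in>E. \<forall>z\<in>E. d x z \<le> d x y + d y z)"

definition qball :: "'a set \<Rightarrow> ('a \<Rightarrow> 'a \<Rightarrow> real) \<Rightarrow> 'a \<Rightarrow> real \<Rightarrow> 'a set" where
  "qball E d x r = {y \<in> E. d x y < r}"

definition qmetric_topology :: "'a set \<Rightarrow> ('a \<Rightarrow> 'a \<Rightarrow> real) \<Rightarrow> 'a topology" where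
  "qmetric_topology E d = topology_generated_by {qball E d x r | x r. x \<in> E \<and> r > 0}"

definition quasi_metric_complete :: "'a set \<Rightarrow> ('a \<Rightarrow> 'a \<Rightarrow> real) \<Rightarrow> bool" where
  "quasi_metric_complete E d \<longleftrightarrow>
     (\<forall>x::nat \<Rightarrow> 'a. range x \<subseteq> E \<and>
        (\<forall>e>0. \<exists>N. \<forall>n\<ge>N. \<forall>p\<ge>n. d (x n) (x p) < e) \<longrightarrow>
        (\<exists>y\<in>E. (\<lambda>n. max (d (x n) y) (d y (x n))) \<longlonglongrightarrow> 0))"

definition quasi_Polish :: "'a topology \<Rightarrow> bool" where
  "quasi_Polish X \<longleftrightarrow> second_countable X \<and>
     (\<exists>d. quasi_metric_on (topspace X) d \<and> quasi_metric_complete (topspace X) d \<and>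
          X = qmetric_topology (topspace X) d)"

definition topological_basis_of :: "'a topology \<Rightarrow> 'a set set \<Rightarrow> bool" where
  "topological_basis_of X \<B> \<longleftrightarrow> (\<forall>V\<in>\<B>. openin X V) \<and>
     (\<forall>U. openin X U \<longrightarrow> (\<exists>\<C>\<subseteq>\<B>. U = \<Union>\<C>))"

definition convergent_approximation_relation ::
  "'a topology \<Rightarrow> 'a set set \<Rightarrow> ('a set \<Rightarrow> 'a set \<Rightarrow> bool) \<Rightarrow> bool" where
  "convergent_approximation_relation X \<B> R \<longleftrightarrow>
     (\<forall>U\<in>\<B>. \<forall>V\<in>\<B>. R U V \<longrightarrow> V \<subseteq> U) \<and>
     (\<forall>U\<in>\<B>. \<forall>V\<in>\<B>. \<forall>T\<in>\<B>. U \<subseteq> T \<and> R U V \<longrightarrow> R T V) \<and>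
     (\<forall>U\<in>\<B>. \<forall>x\<in>U. \<exists>W\<in>\<B>. x \<in> W \<and> R U W) \<and>
     (\<forall>S::nat \<Rightarrow> 'a set. (\<forall>i. S i \<in> \<B> \<and> R (S i) (S (Suc i))) \<longrightarrow>
        (\<exists>x\<in>topspace X. (\<forall>i. x \<in> S i) \<and>
           (\<forall>V. openin X V \<and> x \<in> V \<longrightarrow> (\<exists>i. S i \<subseteq> V))))"

definition convergent_approximation_space :: "'a topology \<Rightarrow> bool" where
  "convergent_approximation_space X \<longleftrightarrow>
     (\<exists>\<B> R. topological_basis_of X \<B> \<and> convergent_approximation_relation X \<B> R)"

end

theory Submission
  imports Defs
begin

text \<open>
  A complete quasi-metric gives countably many requests: for a basic open set \<open>P\<close> and a
  bound \<open>\<epsilon>\<close>, a decreasing sequence of open sets that enters \<open>P\<close> should later enter a ball of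
  radius \<open>\<delta> \<le> \<epsilon>\<close> whose concentric ball of radius \<open>2\<delta>\<close> still lies in \<open>P\<close>. Put \<open>U \<ll> V\<close> if some
  basic open set and some \<open>U'\<close> lie between \<open>V\<close> and \<open>U\<close>, and \<open>V\<close> meets the first unmet request
  of \<open>U'\<close>. Along a chain every request is eventually met, so the chain shrinks to a point.

  Conversely, an approximation relation extends to all open sets. With \<open>f(x)\<close> the least \<open>k\<close> such
  that the \<open>k\<close>-th basic set contains \<open>x\<close>, approximates the \<open>n\<close>-th one and lies in the
  \<open>m\<close>-th one (\<open>f(x) = \<infinity>\<close> if there is none), let \<open>d x y\<close> be small when \<open>f(y) \<le> f(x)\<close>
  for many pairs \<open>(n, m)\<close>. On a Cauchy sequence each \<open>f\<close> is eventually decreasing, hence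
  constant, so the basic sets eventually containing the sequence form a filter in which one
  finds a chain for the approximation relation; its point is the limit.
\<close>

section \<open>Quasi-metric topologies\<close>

lemma quasi_metric_triangle:
  assumes "quasi_metric_on E d" "x \<in> E" "y \<in> E" "z \<in> E"
  shows "d x z \<le> d x y + d y z"
  using assms unfolding quasi_metric_on_def by blast

lemma quasi_metric_refl:
  assumes "quasi_metric_on E d" "x \<in> E"
  shows "d x x = 0"
  using assms unfolding quasi_metric_on_def by blast

lemma qball_shift:
  assumes "quasi_metric_on E d" "x \<in> E" "y \<in> E" "d x y + s \<le> r"
  shows "qball E d y s \<subseteq> qball E d x r"
  using quasi_metric_triangle[OF assms(1,2,3)] assms(4) unfolding qball_def by fastforce

lemma centre_in_qball:
  assumes "quasi_metric_on E d" "x \<in> E" "r > 0"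
  shows "x \<in> qball E d x r"
  using assms quasi_metric_refl[OF assms(1,2)] by (simp add: qball_def)

text \<open>By the triangle inequality the balls form a base, not merely a subbase: each point
  \<open>y\<close> of the ball of radius \<open>r\<close> around \<open>x\<close> has its own ball
  of radius \<open>r - d x y\<close> inside it, and intersections take the smaller radius.\<close>

lemma openin_qmetric_topology:
  assumes qm: "quasi_metric_on E d"
  shows "openin (qmetric_topology E d) U \<longleftrightarrow>
    U \<subseteq> E \<and> (\<forall>x\<in>U. \<exists>r>0. qball E d x r \<subseteq> U)"
proof
  assume "openin (qmetric_topology E d) U"
  then have "generate_topology_on {qball E d x r | x r. x \<in> E \<and> r > 0} U"
    unfolding qmetric_topology_def openin_topology_generated_by_iff .
  then show "U \<subseteq> E \<and> (\<forall>x\<in>U. \<exists>r>0. qball E d x r \<subseteq> U)"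
  proof induction
    case Empty
    then show ?case by simp
  next
    case (Int a b)
    have "\<exists>r>0. qball E d x r \<subseteq> a \<inter> b" if x: "x \<in> a \<inter> b" for x
    proof -
      obtain r s where "r > 0" "qball E d x r \<subseteq> a" "s > 0" "qball E d x s \<subseteq> b"
        using Int.IH x by blast
      then have "min r s > 0" "qball E d x (min r s) \<subseteq> a \<inter> b"
        by (auto simp: qball_def)
      then show ?thesis by blast
    qed
    then show ?case using Int.IH by blast
  next
    case (UN K)
    then show ?case by (meson Sup_least Union_iff Sup_upper order_trans)
  next
    case (Basis s)
    then obtain x r where s: "s = qball E d x r" and x: "x \<in> E" by blast
    have "\<exists>r'>0. qball E d y r' \<subseteq> s" if "y \<in> s" for y
      using that qball_shift[OF qm x, of y "r - d x y" r]
      unfolding s by (intro exI[of _ "r - d x y"]) (simp add: qball_def)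
    then show ?case by (auto simp: s qball_def)
  qed
next
  assume U: "U \<subseteq> E \<and> (\<forall>x\<in>U. \<exists>r>0. qball E d x r \<subseteq> U)"
  show "openin (qmetric_topology E d) U"
  proof (subst openin_subopen, intro ballI)
    fix x assume x: "x \<in> U"
    then obtain r where r: "r > 0" "qball E d x r \<subseteq> U" using U by blast
    have "x \<in> E" using x U by blast
    then have "openin (qmetric_topology E d) (qball E d x r)"
      unfolding qmetric_topology_def by (intro topology_generated_by_Basis) (use r in blast)
    then show "\<exists>T. openin (qmetric_topology E d) T \<and> x \<in> T \<and> T \<subseteq> U"
      using r centre_in_qball[OF qm \<open>x \<in> E\<close>] by blast
  qed
qed

lemma openin_qball:
  assumes qm: "quasi_metric_on E d" and "x \<in> E"
  shows "openin (qmetric_topology E d) (qball E d x r)"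
proof -
  have "\<exists>s>0. qball E d y s \<subseteq> qball E d x r" if "y \<in> qball E d x r" for y
    using that qball_shift[OF assms, of y "r - d x y" r]
    by (intro exI[of _ "r - d x y"]) (simp add: qball_def)
  then show ?thesis
    unfolding openin_qmetric_topology[OF qm] by (auto simp: qball_def)
qed

lemma t0_space_qmetric_topology:
  assumes qm: "quasi_metric_on E d"
  shows "t0_space (qmetric_topology E d)"
proof -
  have sub: "topspace (qmetric_topology E d) \<subseteq> E"
    using openin_qmetric_topology[OF qm] openin_topspace by blast
  have sep: "\<exists>U. openin (qmetric_topology E d) U \<and> x \<in> U \<and> y \<notin> U"
    if "x \<in> E" "d x y > 0" for x y
    using that openin_qball[OF qm \<open>x \<in> E\<close>, of "d x y"] centre_in_qball[OF qm]
    by (intro exI[of _ "qball E d x (d x y)"]) (auto simp: qball_def)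
  show ?thesis
    unfolding t0_space_def
  proof (intro ballI impI)
    fix x y
    assume "x \<in> topspace (qmetric_topology E d)" "y \<in> topspace (qmetric_topology E d)" "x \<noteq> y"
    then have xy: "x \<in> E" "y \<in> E" "x \<noteq> y" using sub by auto
    then have "d x y > 0 \<or> d y x > 0"
      using qm unfolding quasi_metric_on_def by (metis order_le_less)
    then show "\<exists>U. openin (qmetric_topology E d) U \<and> (x \<notin> U) = (y \<in> U)"
      using sep[of x y] sep[of y x] xy by blast
  qed
qed

text \<open>Index 0 is reserved for the whole space, so that one index is known in advance to
  contain all terms of any sequence; the later construction of a chain starts from it.\<close>

definition basis_sequence :: "'a topology \<Rightarrow> (nat \<Rightarrow> 'a set) \<Rightarrow> bool" where
  "basis_sequence X B \<longleftrightarrow> B 0 = topspace X \<and> (\<forall>n. openin X (B n)) \<and>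
    (\<forall>U x. openin X U \<and> x \<in> U \<longrightarrow> (\<exists>n. x \<in> B n \<and> B n \<subseteq> U))"

lemma second_countable_basis_sequence:
  fixes X :: "'a topology"
  assumes "second_countable X"
  shows "\<exists>B. basis_sequence X B"
proof -
  obtain \<D> where cD: "countable \<D>" and oD: "\<And>V. V \<in> \<D> \<Longrightarrow> openin X V"
    and bD: "\<And>U x. openin X U \<Longrightarrow> x \<in> U \<Longrightarrow> \<exists>V\<in>\<D>. x \<in> V \<and> V \<subseteq> U"
    using assms unfolding second_countable_def by metis
  \<comment> \<open>Inserting \<open>{}\<close> keeps the enumerated family nonempty, as
    \<open>from_nat_into\<close> requires; the shift by one frees index 0.\<close>
  define B where "B n = (if n = 0 then topspace X else from_nat_into (insert {} \<D>) (n - 1))" for n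
  have "from_nat_into (insert {} \<D>) m \<in> insert {} \<D>" for m
    by (rule from_nat_into) simp
  then have "openin X (from_nat_into (insert {} \<D>) m)" for m
    using oD by (metis insertE openin_empty)
  then have "\<forall>n. openin X (B n)"
    unfolding B_def by simp
  moreover have "\<exists>n. x \<in> B n \<and> B n \<subseteq> U" if xU: "openin X U" "x \<in> U" for U x
  proof -
    obtain V where V: "V \<in> \<D>" "x \<in> V" "V \<subseteq> U" using bD[OF xU] by blast
    then have "B (Suc (to_nat_on (insert {} \<D>) V)) = V"
      unfolding B_def using cD by simp
    then show ?thesis using V by metis
  qed
  moreover have "B 0 = topspace X" by (simp add: B_def)
  ultimately have "basis_sequence X B" unfolding basis_sequence_def by simp
  then show ?thesis by blast
qed

section \<open>From a complete quasi-metric to an approximation relation\<close>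

text \<open>Request \<open>n\<close> is triggered by entering \<open>P n\<close>, and
  \<open>H n U\<close> says that \<open>U\<close> meets it.\<close>

definition unmet :: "(nat \<Rightarrow> 'a set) \<Rightarrow> (nat \<Rightarrow> 'a set \<Rightarrow> bool) \<Rightarrow> nat \<Rightarrow> 'a set \<Rightarrow> bool" where
  "unmet P H n U \<longleftrightarrow> U \<subseteq> P n \<and> \<not> H n U"

text \<open>Quantifying over an intermediate \<open>U'\<close> makes the relation monotone in \<open>U\<close>: a larger set may
  have a later first unmet request, so \<open>U' = U\<close> alone would not do.\<close>

definition meets_first ::
  "(nat \<Rightarrow> 'a set) \<Rightarrow> (nat \<Rightarrow> 'a set \<Rightarrow> bool) \<Rightarrow> 'a set \<Rightarrow> 'a set \<Rightarrow> bool" where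
  "meets_first P H U V \<longleftrightarrow> (\<exists>U'. V \<subseteq> U' \<and> U' \<subseteq> U \<and>
     (\<forall>n. unmet P H n U' \<and> (\<forall>m<n. \<not> unmet P H m U') \<longrightarrow> H n V))"

text \<open>Strong induction on the request number. From some index \<open>J\<close> on, every
  smaller request that is ever triggered has been met, so request \<open>n\<close>, if still open,
  is the first unmet one and the next set must meet it.\<close>

lemma meets_first_chain:
  assumes anti: "\<And>n U V. H n U \<Longrightarrow> V \<subseteq> U \<Longrightarrow> H n V"
    and sub: "\<And>n U. H n U \<Longrightarrow> U \<subseteq> P n"
    and chain: "\<And>i. meets_first P H (S i) (S (Suc i))"
    and req: "S i \<subseteq> P n"
  shows "\<exists>j. H n (S j)"
  using req
proof (induction n arbitrary: i rule: less_induct)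
  case (less n)
  have dec: "decseq S"
    using chain unfolding decseq_Suc_iff meets_first_def by blast
  have "\<forall>m\<in>{..<n}. \<forall>\<^sub>F j in sequentially. (\<exists>i. S i \<subseteq> P m) \<longrightarrow> H m (S j)"
  proof
    fix m assume m: "m \<in> {..<n}"
    show "\<forall>\<^sub>F j in sequentially. (\<exists>i. S i \<subseteq> P m) \<longrightarrow> H m (S j)"
    proof (cases "\<exists>i. S i \<subseteq> P m")
      case True
      then obtain j where "H m (S j)" using less.IH m by blast
      then show ?thesis
        using anti dec by (intro eventually_sequentiallyI[of j]) (auto dest: decseqD)
    qed simp
  qed
  then have "\<forall>\<^sub>F j in sequentially. \<forall>m\<in>{..<n}. (\<exists>i. S i \<subseteq> P m) \<longrightarrow> H m (S j)"
    by (rule eventually_ball_finite[OF finite_lessThan])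
  then obtain J where J: "\<And>j m. j \<ge> J \<Longrightarrow> m < n \<Longrightarrow> (\<exists>i. S i \<subseteq> P m) \<Longrightarrow> H m (S j)"
    unfolding eventually_sequentially by blast
  define j where "j = max i J"
  obtain U where U: "S (Suc j) \<subseteq> U" "U \<subseteq> S j"
    and first: "\<And>m. unmet P H m U \<Longrightarrow> (\<And>l. l < m \<Longrightarrow> \<not> unmet P H l U) \<Longrightarrow> H m (S (Suc j))"
    using chain[of j] unfolding meets_first_def by blast
  show ?case
  proof (cases "H n U")
    case True
    then show ?thesis using anti U by blast
  next
    case False
    have "U \<subseteq> P n" using U less.prems decseqD[OF dec, of i j] by (auto simp: j_def)
    with False have n: "unmet P H n U" by (simp add: unmet_def)
    define m where "m = (LEAST m. unmet P H m U)"
    have m: "unmet P H m U" "m \<le> n" "\<And>l. l < m \<Longrightarrow> \<not> unmet P H l U"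
      using n unfolding m_def by (auto intro: LeastI Least_le dest: not_less_Least)
    then have Hm: "H m (S (Suc j))" using first by blast
    \<comment> \<open>A smaller \<open>m\<close> would be met by \<open>S (Suc j)\<close>, hence
      triggered along the chain; by the choice of \<open>J\<close> it was already met by
      \<open>S j\<close>, and so by \<open>U\<close>.\<close>
    have "m = n"
    proof (rule ccontr)
      assume "m \<noteq> n"
      then have "m < n" using m by simp
      then have "H m (S j)" using J[of j m] sub[OF Hm] by (auto simp: j_def)
      then show False using anti U m unfolding unmet_def by blast
    qed
    then show ?thesis using Hm by blast
  qed
qed

text \<open>Only one request matters, the first unmet one of \<open>U\<close>; a neighbourhood
  solving it works with \<open>U\<close> itself as the intermediate set. The claim covers all
  subsets of \<open>W\<close>, so that \<open>W\<close> can be shrunk to a basic set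
  afterwards.\<close>

lemma meets_first_exists:
  assumes "openin X U" "x \<in> U"
    and solve: "\<And>n. x \<in> P n \<Longrightarrow> \<exists>W. openin X W \<and> x \<in> W \<and> H n W"
    and anti: "\<And>n U V. H n U \<Longrightarrow> V \<subseteq> U \<Longrightarrow> H n V"
  shows "\<exists>W. openin X W \<and> x \<in> W \<and> W \<subseteq> U \<and> (\<forall>V\<subseteq>W. meets_first P H U V)"
proof (cases "\<exists>n. unmet P H n U")
  case True
  define n where "n = (LEAST n. unmet P H n U)"
  have n: "unmet P H n U" "\<And>m. unmet P H m U \<Longrightarrow> n \<le> m"
    using True unfolding n_def by (auto intro: LeastI Least_le)
  obtain W where "openin X W" "x \<in> W" "H n W"
    using n solve assms(2) unfolding unmet_def by blast
  moreover have "meets_first P H U V" if "V \<subseteq> W \<inter> U" for V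
  proof -
    have "m = n" if "unmet P H m U \<and> (\<forall>l<m. \<not> unmet P H l U)" for m
      using that n by (meson linorder_not_less nle_le)
    then show ?thesis
      using that anti[OF \<open>H n W\<close>] unfolding meets_first_def by (intro exI[of _ U]) auto
  qed
  ultimately show ?thesis
    using assms by (intro exI[of _ "W \<inter> U"]) (simp add: openin_Int)
next
  case False
  then have "meets_first P H U V" if "V \<subseteq> U" for V
    using that unfolding meets_first_def by blast
  then show ?thesis using assms by blast
qed

section \<open>The approximation relation of a complete quasi-metric\<close>

lemma quasi_Polish_imp_convergent_approximation_space:
  assumes "quasi_Polish X"
  shows "convergent_approximation_space X"
proof -
  define E where "E = topspace X"
  obtain d where sc: "second_countable X" and qm: "quasi_metric_on E d"
    and complete: "quasi_metric_complete E d" and X: "X = qmetric_topology E d"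
    using assms unfolding quasi_Polish_def E_def by blast
  obtain B where B: "basis_sequence X B"
    using second_countable_basis_sequence[OF sc] by (rule exE)
  have oB: "openin X (B n)" for n
    using B by (simp add: basis_sequence_def)
  have bB: "\<exists>n. x \<in> B n \<and> B n \<subseteq> U" if "openin X U" "x \<in> U" for U x
    using B that by (simp add: basis_sequence_def)
  \<comment> \<open>The number \<open>n\<close> codes a basic set and a tolerance. The doubled
    radius leaves room for the limit of the centres, which need not stay in the ball of radius
    \<delta>.\<close>
  define H where "H n V \<longleftrightarrow> (\<exists>y\<in>E. \<exists>\<delta>>0. \<delta> \<le> 1 / real (Suc (snd (prod_decode n))) \<and>
    V \<subseteq> qball E d y \<delta> \<and> qball E d y (2 * \<delta>) \<subseteq> B (fst (prod_decode n)))" for n V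
  define P where "P n = B (fst (prod_decode n))" for n
  \<comment> \<open>Chains consist of arbitrary open sets, but requests concern only the sets
    \<open>B n\<close>; the interposed \<open>B n\<close> makes each link of a chain trigger
    requests.\<close>
  define R where "R U V \<longleftrightarrow> (\<exists>n. V \<subseteq> B n \<and> B n \<subseteq> U) \<and> meets_first P H U V" for U V
  have anti: "H n V" if "H n U" "V \<subseteq> U" for n U V
    using that unfolding H_def by (meson order_trans)
  have sub: "U \<subseteq> P n" if met: "H n U" for n U
  proof -
    obtain y \<delta> where "\<delta> > 0" "U \<subseteq> qball E d y \<delta>" "qball E d y (2 * \<delta>) \<subseteq> P n"
      using met unfolding H_def P_def by blast
    moreover from \<open>\<delta> > 0\<close> have "qball E d y \<delta> \<subseteq> qball E d y (2 * \<delta>)"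
      by (auto simp: qball_def)
    ultimately show ?thesis by blast
  qed
  have solve: "\<exists>W. openin X W \<and> x \<in> W \<and> H n W" if x: "x \<in> P n" for x n
  proof -
    have "openin X (P n)" by (simp add: P_def oB)
    then obtain r where r: "r > 0" "qball E d x r \<subseteq> P n" and "x \<in> E"
      using x unfolding X openin_qmetric_topology[OF qm] by blast
    define \<delta> where "\<delta> = min (r / 2) (1 / real (Suc (snd (prod_decode n))))"
    have "\<delta> > 0" "2 * \<delta> \<le> r" "\<delta> \<le> 1 / real (Suc (snd (prod_decode n)))"
      using r by (auto simp: \<delta>_def)
    moreover from this have "qball E d x (2 * \<delta>) \<subseteq> P n"
      using r by (force simp: qball_def)
    ultimately have "H n (qball E d x \<delta>)"
      unfolding H_def P_def[symmetric] using \<open>x \<in> E\<close> by blast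
    then show ?thesis
      using openin_qball[OF qm \<open>x \<in> E\<close>] centre_in_qball[OF qm \<open>x \<in> E\<close> \<open>\<delta> > 0\<close>] X by metis
  qed
  have conv: "\<exists>x\<in>topspace X. (\<forall>i. x \<in> S i) \<and> (\<forall>V. openin X V \<and> x \<in> V \<longrightarrow> (\<exists>i. S i \<subseteq> V))"
    if S: "\<forall>i::nat. S i \<in> Collect (openin X) \<and> R (S i) (S (Suc i))" for S
  proof -
    have chain: "meets_first P H (S i) (S (Suc i))" for i using S by (simp add: R_def)
    have dec: "decseq S"
      using chain unfolding decseq_Suc_iff meets_first_def by blast
    have step: "\<exists>j>i. \<exists>y\<in>E. \<exists>\<delta>>0. \<delta> \<le> 1 / real (Suc i) \<and>
        S j \<subseteq> qball E d y \<delta> \<and> qball E d y (2 * \<delta>) \<subseteq> S i" for i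
    proof -
      obtain n where n: "S (Suc i) \<subseteq> B n" "B n \<subseteq> S i" using S unfolding R_def by blast
      then have "S (Suc i) \<subseteq> P (prod_encode (n, i))" by (simp add: P_def)
      with sub anti chain have "\<exists>j. H (prod_encode (n, i)) (S j)"
        by (intro meets_first_chain[where P = P])
      then obtain j where "H (prod_encode (n, i)) (S j)" by blast
      then obtain y \<delta> where y: "y \<in> E" "\<delta> > 0" "\<delta> \<le> 1 / real (Suc i)"
        "S j \<subseteq> qball E d y \<delta>" "qball E d y (2 * \<delta>) \<subseteq> B n" unfolding H_def by auto
      then have "S (max j (Suc i)) \<subseteq> qball E d y \<delta>" "qball E d y (2 * \<delta>) \<subseteq> S i"
        using n decseqD[OF dec, of j "max j (Suc i)"] by auto
      moreover have "max j (Suc i) > i" by simp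
      ultimately show ?thesis using y by blast
    qed
    then obtain next_i y \<delta> where gt: "\<And>i. next_i i > i" and yE: "\<And>i. y i \<in> E"
      and \<delta>: "\<And>i. \<delta> i > 0" "\<And>i. \<delta> i \<le> 1 / real (Suc i)"
      and inner: "\<And>i. S (next_i i) \<subseteq> qball E d (y i) (\<delta> i)"
      and outer: "\<And>i. qball E d (y i) (2 * \<delta> i) \<subseteq> S i"
      by metis
    \<comment> \<open>Along this subsequence the ball chosen at \<open>s n\<close> contains
      \<open>S (s (Suc n))\<close>, hence all later centres.\<close>
    define s where "s n = (next_i ^^ n) 0" for n :: nat
    have s_Suc: "s (Suc n) = next_i (s n)" for n by (simp add: s_def)
    have "strict_mono s" using gt by (simp add: strict_mono_Suc_iff s_Suc)
    then have s_ge: "n \<le> s n" for n by (rule strict_mono_imp_increasing)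
    have dist: "d (y (s n)) (y (s p)) < \<delta> (s n)" if "n \<le> p" for n p
    proof (cases "n = p")
      case True
      then show ?thesis using quasi_metric_refl[OF qm yE] \<delta> by simp
    next
      case False
      then have "s (Suc n) \<le> s p" using that \<open>strict_mono s\<close> by (simp add: strict_mono_less_eq)
      moreover have "y (s p) \<in> S (s p)"
        using outer centre_in_qball[OF qm yE, of "2 * \<delta> (s p)" "s p"] \<delta> by auto
      ultimately have "y (s p) \<in> qball E d (y (s n)) (\<delta> (s n))"
        using decseqD[OF dec] inner unfolding s_Suc by blast
      then show ?thesis by (simp add: qball_def)
    qed
    have small: "\<exists>N. \<forall>n\<ge>N. \<delta> (s n) < e" if "e > 0" for e
    proof -
      obtain N where N: "1 / real (Suc N) < e" using \<open>e > 0\<close> nat_approx_posE by blast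
      have "\<delta> (s n) < e" if "n \<ge> N" for n
      proof -
        have "\<delta> (s n) \<le> 1 / real (Suc (s n))" by (rule \<delta>)
        also have "\<dots> \<le> 1 / real (Suc N)"
          using s_ge[of n] that by (intro divide_left_mono) auto
        finally show ?thesis using N by simp
      qed
      then show ?thesis by blast
    qed
    have "\<forall>e>0. \<exists>N. \<forall>n\<ge>N. \<forall>p\<ge>n. d (y (s n)) (y (s p)) < e"
      using small dist by (meson order_less_trans)
    then obtain x where x: "x \<in> E"
      and "(\<lambda>n. max (d (y (s n)) x) (d x (y (s n)))) \<longlonglongrightarrow> 0"
      using complete[unfolded quasi_metric_complete_def, rule_format, of "\<lambda>n. y (s n)"] yE
      by blast
    then have lim: "\<exists>N. \<forall>n\<ge>N. d (y (s n)) x < e \<and> d x (y (s n)) < e" if "e > 0" for e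
      using that unfolding tendsto_iff eventually_sequentially dist_real_def by fastforce
    \<comment> \<open>A late centre is within \<delta> of \<open>y (s i)\<close> and
      \<open>x\<close> is within \<delta> of that centre, so the doubled ball, which lies in
      \<open>S (s i)\<close>, contains \<open>x\<close>.\<close>
    have in_S: "x \<in> S i" for i
    proof -
      obtain N where N: "\<And>n. n \<ge> N \<Longrightarrow> d (y (s n)) x < \<delta> (s i)"
        using lim[OF \<delta>(1)] by blast
      define n where "n = max i N"
      have "d (y (s i)) x \<le> d (y (s i)) (y (s n)) + d (y (s n)) x"
        by (rule quasi_metric_triangle[OF qm yE yE x])
      also have "\<dots> < 2 * \<delta> (s i)" using dist[of i n] N[of n] by (simp add: n_def)
      finally have "x \<in> S (s i)" using outer x by (auto simp: qball_def)
      then show ?thesis using decseqD[OF dec s_ge[of i]] by blast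
    qed
    have "\<exists>i. S i \<subseteq> V" if V: "openin X V" "x \<in> V" for V
    proof -
      obtain r where r: "r > 0" "qball E d x r \<subseteq> V"
        using V unfolding X openin_qmetric_topology[OF qm] by blast
      obtain N M where N: "\<And>n. n \<ge> N \<Longrightarrow> d x (y (s n)) < r / 2"
        and M: "\<And>n. n \<ge> M \<Longrightarrow> \<delta> (s n) < r / 2"
        using lim[of "r / 2"] small[of "r / 2"] r by auto
      define n where "n = max N M"
      have "d x (y (s n)) + \<delta> (s n) \<le> r" using N[of n] M[of n] by (simp add: n_def)
      then have "S (s (Suc n)) \<subseteq> V"
        using inner qball_shift[OF qm x yE] r unfolding s_Suc by blast
      then show ?thesis by blast
    qed
    then show ?thesis using in_S x E_def by blast
  qed
  have "convergent_approximation_relation X (Collect (openin X)) R"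
    unfolding convergent_approximation_relation_def
  proof (intro conjI ballI allI impI)
    fix U V assume "R U V"
    then show "V \<subseteq> U" unfolding R_def by blast
  next
    fix U V T assume "U \<subseteq> T \<and> R U V"
    then show "R T V" unfolding R_def meets_first_def by (meson order_trans)
  next
    fix U x assume U: "U \<in> Collect (openin X)" "x \<in> U"
    obtain W where W: "openin X W" "x \<in> W" "W \<subseteq> U" "\<And>V. V \<subseteq> W \<Longrightarrow> meets_first P H U V"
      using meets_first_exists[of X U x P H] U solve anti by (metis mem_Collect_eq)
    then obtain n where "x \<in> B n" "B n \<subseteq> W" using bB by metis
    then show "\<exists>W\<in>Collect (openin X). x \<in> W \<and> R U W"
      using W oB unfolding R_def by blast
  qed (rule conv)
  moreover have "topological_basis_of X (Collect (openin X))"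
    unfolding topological_basis_of_def
    by (metis cSup_singleton empty_subsetI insert_subset mem_Collect_eq)
  ultimately show ?thesis unfolding convergent_approximation_space_def by blast
qed

section \<open>From an approximation relation to a complete quasi-metric\<close>

text \<open>The given basis need not be the countable one. Interposing a related pair of its members
  between two sets frees the relation from that basis and makes it monotone on both sides.\<close>

lemma convergent_approximation_relation_open_sets:
  fixes X :: "'a topology"
  assumes "convergent_approximation_space X"
  shows "\<exists>R. (\<forall>U x. openin X U \<and> x \<in> U \<longrightarrow>
      (\<exists>W. openin X W \<and> x \<in> W \<and> W \<subseteq> U \<and> (\<forall>V\<subseteq>W. R U V))) \<and>
    (\<forall>S :: nat \<Rightarrow> 'a set. (\<forall>i. R (S i) (S (Suc i))) \<longrightarrow>
      (\<exists>x\<in>topspace X. (\<forall>i. x \<in> S i) \<and> (\<forall>V. openin X V \<and> x \<in> V \<longrightarrow> (\<exists>i. S i \<subseteq> V))))"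
proof -
  obtain \<B> R0 where basis: "topological_basis_of X \<B>"
    and rel: "convergent_approximation_relation X \<B> R0"
    using assms unfolding convergent_approximation_space_def by blast
  have R1: "\<forall>U\<in>\<B>. \<forall>V\<in>\<B>. R0 U V \<longrightarrow> V \<subseteq> U"
    using rel unfolding convergent_approximation_relation_def by (elim conjE)
  have R2: "\<forall>U\<in>\<B>. \<forall>V\<in>\<B>. \<forall>T\<in>\<B>. U \<subseteq> T \<and> R0 U V \<longrightarrow> R0 T V"
    using rel unfolding convergent_approximation_relation_def by (elim conjE)
  have R3: "\<forall>U\<in>\<B>. \<forall>x\<in>U. \<exists>W\<in>\<B>. x \<in> W \<and> R0 U W"
    using rel unfolding convergent_approximation_relation_def by (elim conjE)
  have R4: "\<forall>S::nat \<Rightarrow> 'a set. (\<forall>i. S i \<in> \<B> \<and> R0 (S i) (S (Suc i))) \<longrightarrow>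
      (\<exists>x\<in>topspace X. (\<forall>i. x \<in> S i) \<and> (\<forall>V. openin X V \<and> x \<in> V \<longrightarrow> (\<exists>i. S i \<subseteq> V)))"
    using rel unfolding convergent_approximation_relation_def by (elim conjE)
  define R where "R U V \<longleftrightarrow> (\<exists>U0\<in>\<B>. \<exists>W\<in>\<B>. U0 \<subseteq> U \<and> R0 U0 W \<and> V \<subseteq> W)" for U V
  show ?thesis
  proof (intro exI[of _ R] conjI allI impI)
    fix U x assume U: "openin X U \<and> x \<in> U"
    obtain U0 where U0: "U0 \<in> \<B>" "x \<in> U0" "U0 \<subseteq> U"
      using U basis unfolding topological_basis_of_def by blast
    then obtain W where W: "W \<in> \<B>" "x \<in> W" "R0 U0 W" using R3 by blast
    have "openin X W"
      using basis W(1) unfolding topological_basis_of_def by simp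
    moreover have "W \<subseteq> U"
      using R1 U0 W by (meson order_trans)
    ultimately show "\<exists>W. openin X W \<and> x \<in> W \<and> W \<subseteq> U \<and> (\<forall>V\<subseteq>W. R U V)"
      using U0 W unfolding R_def by blast
  next
    fix S :: "nat \<Rightarrow> 'a set"
    assume "\<forall>i. R (S i) (S (Suc i))"
    then obtain U W where UW: "\<And>i. U i \<in> \<B>" "\<And>i. W i \<in> \<B>" "\<And>i. U i \<subseteq> S i"
      "\<And>i. R0 (U i) (W i)" "\<And>i. S (Suc i) \<subseteq> W i"
      unfolding R_def by metis
    \<comment> \<open>Here \<open>U (Suc i)\<close> lies in \<open>S (Suc i)\<close> and so in
      \<open>W i\<close>; condition (2) enlarges it to \<open>W i\<close>.\<close>
    have "R0 (W i) (W (Suc i))" for i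
      using R2[rule_format, OF UW(1) UW(2) UW(2)] UW(3,4,5) by (meson order_trans)
    with UW(2) have "\<exists>x\<in>topspace X. (\<forall>i. x \<in> W i) \<and>
        (\<forall>V. openin X V \<and> x \<in> V \<longrightarrow> (\<exists>i. W i \<subseteq> V))"
      using R4[rule_format, of W] by simp
    then obtain x where x: "x \<in> topspace X" "\<forall>i. x \<in> W i"
      "\<forall>V. openin X V \<and> x \<in> V \<longrightarrow> (\<exists>i. W i \<subseteq> V)"
      by blast
    have "W i \<subseteq> S i" for i
      using R1[rule_format, OF UW(1) UW(2) UW(4)] UW(3) by blast
    with x(2) have "\<forall>i. x \<in> S i" by blast
    moreover have "\<forall>V. openin X V \<and> x \<in> V \<longrightarrow> (\<exists>i. S i \<subseteq> V)"
      using x(3) UW(5) by (meson order_trans)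
    ultimately show
      "\<exists>x\<in>topspace X. (\<forall>i. x \<in> S i) \<and> (\<forall>V. openin X V \<and> x \<in> V \<longrightarrow> (\<exists>i. S i \<subseteq> V))"
      using x(1) by blast
  qed
qed

text \<open>\<open>f(y) \<le> f(x)\<close> for \<open>f\<close> the first index of a set containing the point (\<open>\<infinity>\<close> if there is none).\<close>

definition first_index_le :: "(nat \<Rightarrow> 'a set) \<Rightarrow> 'a \<Rightarrow> 'a \<Rightarrow> bool" where
  "first_index_le W x y \<longleftrightarrow> (\<forall>k. x \<in> W k \<longrightarrow> (\<exists>j\<le>k. y \<in> W j))"

lemma first_index_le_refl: "first_index_le W x x"
  unfolding first_index_le_def by blast

lemma first_index_le_trans:
  "first_index_le W x y \<Longrightarrow> first_index_le W y z \<Longrightarrow> first_index_le W x z"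
  unfolding first_index_le_def by (meson order_trans)

text \<open>Only the least \<open>k\<close> with \<open>x\<close> in \<open>W k\<close> matters: any
  \<open>y\<close> in that same set has first index at most \<open>k\<close>.\<close>

lemma first_index_le_eventually:
  assumes "\<And>k. x \<in> W k \<Longrightarrow> \<forall>\<^sub>F y in F. y \<in> W k"
  shows "\<forall>\<^sub>F y in F. first_index_le W x y"
proof (cases "\<exists>k. x \<in> W k")
  case True
  define k where "k = (LEAST k. x \<in> W k)"
  have k: "x \<in> W k" "\<And>j. x \<in> W j \<Longrightarrow> k \<le> j"
    using True unfolding k_def by (auto intro: LeastI Least_le)
  have "\<forall>\<^sub>F y in F. y \<in> W k" using assms k by blast
  then show ?thesis
    by eventually_elim (use k in \<open>auto simp: first_index_le_def\<close>)
qed (simp add: first_index_le_def)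

text \<open>First indices decrease from \<open>N\<close> on, so they stabilise at the least value
  \<open>j\<close> ever reached there.\<close>

lemma first_index_le_Cauchy:
  assumes "\<And>p q. N \<le> p \<Longrightarrow> p \<le> q \<Longrightarrow> first_index_le W (x p) (x q)"
    and "N \<le> p" "x p \<in> W k"
  shows "\<exists>j\<le>k. \<forall>\<^sub>F q in sequentially. x q \<in> W j"
proof -
  define j where "j = (LEAST j. \<exists>p\<ge>N. x p \<in> W j)"
  have "\<exists>p\<ge>N. x p \<in> W j" unfolding j_def by (rule LeastI[of _ k]) (use assms in blast)
  then obtain p' where p': "p' \<ge> N" "x p' \<in> W j" by blast
  have least: "j \<le> i" if "q \<ge> N" "x q \<in> W i" for q i
    unfolding j_def by (rule Least_le) (use that in blast)
  have "x q \<in> W j" if q: "q \<ge> p'" for q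
  proof -
    obtain i where "i \<le> j" "x q \<in> W i"
      using assms(1)[OF p'(1) q] p'(2) unfolding first_index_le_def by blast
    then show ?thesis using least[of q i] p' q by simp
  qed
  then have "\<forall>\<^sub>F q in sequentially. x q \<in> W j" by (rule eventually_sequentiallyI)
  then show ?thesis using least assms by blast
qed

text \<open>The distance records the first comparison that fails, so a ball of radius 1/(N+1) is cut
  out by the comparisons 0 to N.\<close>

definition index_dist :: "(nat \<Rightarrow> nat \<Rightarrow> 'a set) \<Rightarrow> 'a \<Rightarrow> 'a \<Rightarrow> real" where
  "index_dist W x y = (if \<forall>n. first_index_le (W n) x y then 0
     else 1 / real (Suc (LEAST n. \<not> first_index_le (W n) x y)))"

lemma index_dist_less_iff:
  "index_dist W x y < 1 / real (Suc N) \<longleftrightarrow> (\<forall>n\<le>N. first_index_le (W n) x y)"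
proof (cases "\<forall>n. first_index_le (W n) x y")
  case False
  define m where "m = (LEAST n. \<not> first_index_le (W n) x y)"
  have m: "\<not> first_index_le (W m) x y" "\<And>n. n < m \<Longrightarrow> first_index_le (W n) x y"
    using False unfolding m_def by (metis (mono_tags, lifting) LeastI, metis not_less_Least)
  have "index_dist W x y = 1 / real (Suc m)" using False by (simp add: index_dist_def m_def)
  then have "index_dist W x y < 1 / real (Suc N) \<longleftrightarrow> N < m"
    by (simp add: divide_less_cancel inverse_less_iff_less flip: inverse_eq_divide)
  also have "\<dots> \<longleftrightarrow> (\<forall>n\<le>N. first_index_le (W n) x y)"
    using m by (meson leI le_less_trans)
  finally show ?thesis .
qed (simp add: index_dist_def)

lemma index_dist_nonneg: "0 \<le> index_dist W x y"
  by (simp add: index_dist_def)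

lemma index_dist_eq_0: "index_dist W x y = 0 \<longleftrightarrow> (\<forall>n. first_index_le (W n) x y)"
  by (simp add: index_dist_def)

text \<open>If comparison \<open>m\<close> is the first to fail from \<open>x\<close> to
  \<open>z\<close>, transitivity makes it fail on one of the two legs, whose distance is then at
  least 1/(m+1).\<close>

lemma index_dist_triangle: "index_dist W x z \<le> index_dist W x y + index_dist W y z"
proof (cases "\<forall>n. first_index_le (W n) x z")
  case True
  then have "index_dist W x z = 0" by (simp add: index_dist_eq_0)
  then show ?thesis using index_dist_nonneg[of W x y] index_dist_nonneg[of W y z] by simp
next
  case False
  define m where "m = (LEAST n. \<not> first_index_le (W n) x z)"
  have m: "\<not> first_index_le (W m) x z" using False unfolding m_def by (metis (mono_tags, lifting) LeastI)
  then consider "\<not> first_index_le (W m) x y" | "\<not> first_index_le (W m) y z"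
    using first_index_le_trans by metis
  then have "\<not> index_dist W x y < 1 / real (Suc m) \<or> \<not> index_dist W y z < 1 / real (Suc m)"
    unfolding index_dist_less_iff by cases auto
  moreover have "index_dist W x z = 1 / real (Suc m)"
    using False by (simp add: index_dist_def m_def)
  ultimately show ?thesis
    using index_dist_nonneg[of W x y] index_dist_nonneg[of W y z] by linarith
qed

text \<open>A bound \<open>e\<close> involves only finitely many comparisons, so they may be treated
  one at a time.\<close>

lemma index_dist_eventually_less:
  assumes "\<And>n. \<forall>\<^sub>F i in F. first_index_le (W n) (f i) (g i)" "e > 0"
  shows "\<forall>\<^sub>F i in F. index_dist W (f i) (g i) < e"
proof -
  obtain N where N: "1 / real (Suc N) < e" using \<open>e > 0\<close> nat_approx_posE by blast
  have "\<forall>\<^sub>F i in F. \<forall>n\<in>{..N}. first_index_le (W n) (f i) (g i)"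
    by (rule eventually_ball_finite) (use assms in auto)
  then have "\<forall>\<^sub>F i in F. index_dist W (f i) (g i) < 1 / real (Suc N)"
    by eventually_elim (simp only: index_dist_less_iff atMost_iff Ball_def)
  then show ?thesis
    by eventually_elim (erule order_less_trans[OF _ N])
qed

lemma quasi_metric_on_index_dist:
  assumes "\<And>x y. x \<in> E \<Longrightarrow> y \<in> E \<Longrightarrow> (\<And>n. first_index_le (W n) x y) \<Longrightarrow>
    (\<And>n. first_index_le (W n) y x) \<Longrightarrow> x = y"
  shows "quasi_metric_on E (index_dist W)"
  unfolding quasi_metric_on_def index_dist_eq_0
  using assms index_dist_nonneg index_dist_triangle first_index_le_refl by metis

text \<open>Separation puts a ball inside each open set; conversely each comparison from
  \<open>x\<close> holds near \<open>x\<close> because the \<open>W n k\<close> are open, so balls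
  are neighbourhoods.\<close>

lemma qmetric_topology_index_dist:
  assumes qm: "quasi_metric_on (topspace X) (index_dist W)"
    and oW: "\<And>n k. openin X (W n k)"
    and sep: "\<And>U x. openin X U \<Longrightarrow> x \<in> U \<Longrightarrow>
      \<exists>n. \<forall>y\<in>topspace X. first_index_le (W n) x y \<longrightarrow> y \<in> U"
  shows "X = qmetric_topology (topspace X) (index_dist W)"
  unfolding topology_eq openin_qmetric_topology[OF qm]
proof (intro allI iffI conjI ballI)
  fix U assume U: "openin X U"
  show "U \<subseteq> topspace X" by (rule openin_subset[OF U])
  fix x assume "x \<in> U"
  then obtain n where "\<forall>y\<in>topspace X. first_index_le (W n) x y \<longrightarrow> y \<in> U"
    using sep U by blast
  then have "qball (topspace X) (index_dist W) x (1 / real (Suc n)) \<subseteq> U"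
    unfolding qball_def index_dist_less_iff by auto
  then show "\<exists>r>0. qball (topspace X) (index_dist W) x r \<subseteq> U"
    by (intro exI[of _ "1 / real (Suc n)"]) simp
next
  fix U
  assume U: "U \<subseteq> topspace X \<and> (\<forall>x\<in>U. \<exists>r>0. qball (topspace X) (index_dist W) x r \<subseteq> U)"
  show "openin X U"
  proof (subst openin_subopen, intro ballI)
    fix x assume x: "x \<in> U"
    then obtain r where r: "r > 0" "qball (topspace X) (index_dist W) x r \<subseteq> U" using U by blast
    have xX: "x \<in> topspace X" using x U by blast
    have "\<forall>\<^sub>F y in nhdsin X x. first_index_le (W n) x y" for n
      by (rule first_index_le_eventually) (use xX oW in \<open>auto simp: eventually_nhdsin\<close>)
    then have "\<forall>\<^sub>F y in nhdsin X x. index_dist W x y < r"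
      using r by (intro index_dist_eventually_less)
    then obtain T where "openin X T" "x \<in> T" "\<forall>y\<in>T. index_dist W x y < r"
      using xX by (auto simp: eventually_nhdsin)
    moreover from this have "T \<subseteq> U"
      using r openin_subset[of X T] by (auto simp: qball_def)
    ultimately show "\<exists>T. openin X T \<and> x \<in> T \<and> T \<subseteq> U" by blast
  qed
qed

section \<open>The complete quasi-metric of an approximation space\<close>

lemma convergent_approximation_space_imp_quasi_Polish:
  fixes X :: "'a topology"
  assumes t0: "t0_space X" and ca: "convergent_approximation_space X"
    and sc: "second_countable X"
  shows "quasi_Polish X"
proof -
  obtain B where B: "basis_sequence X B"
    using second_countable_basis_sequence[OF sc] by (rule exE)
  have oB: "openin X (B n)" for n
    using B by (simp add: basis_sequence_def)
  have bB: "\<exists>n. x \<in> B n \<and> B n \<subseteq> U" if "openin X U" "x \<in> U" for U x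
    using B that by (simp add: basis_sequence_def)
  have B0: "B 0 = topspace X"
    using B by (simp add: basis_sequence_def)
  obtain R where R_ex: "\<forall>U x. openin X U \<and> x \<in> U \<longrightarrow>
      (\<exists>W. openin X W \<and> x \<in> W \<and> W \<subseteq> U \<and> (\<forall>V\<subseteq>W. R U V))"
    and R_conv: "\<forall>S :: nat \<Rightarrow> 'a set. (\<forall>i. R (S i) (S (Suc i))) \<longrightarrow>
      (\<exists>x\<in>topspace X. (\<forall>i. x \<in> S i) \<and> (\<forall>V. openin X V \<and> x \<in> V \<longrightarrow> (\<exists>i. S i \<subseteq> V)))"
    using convergent_approximation_relation_open_sets[OF ca] by (elim exE conjE) (rule that)
  define ok where "ok n k \<longleftrightarrow> R (B (fst (prod_decode n))) (B k) \<and> B k \<subseteq> B (snd (prod_decode n))" for n k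
  \<comment> \<open>Unsuitable indices get the empty set, so the first index of a point skips
    them.\<close>
  define W where "W n k = (if ok n k then B k else {})" for n k
  have oW: "openin X (W n k)" for n k by (simp add: W_def oB)
  have cover: "\<exists>k. x \<in> W (prod_encode (n, m)) k" if x: "x \<in> B n" "x \<in> B m" for n m x
  proof -
    obtain V where V: "openin X V" "x \<in> V" "\<And>T. T \<subseteq> V \<Longrightarrow> R (B n) T"
      using R_ex oB x(1) by metis
    then obtain k where "x \<in> B k" "B k \<subseteq> V \<inter> B m"
      using bB[of "V \<inter> B m" x] oB x openin_Int by blast
    then show ?thesis using V by (auto simp: W_def ok_def)
  qed
  \<comment> \<open>On the diagonal pair every nonempty \<open>W\<close> set lies in
    \<open>B n\<close>, and \<open>cover\<close> gives \<open>x\<close> a finite first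
    index.\<close>
  have le_B: "y \<in> B n" if le: "first_index_le (W (prod_encode (n, n))) x y" and x: "x \<in> B n" for x y n
  proof -
    obtain k where "x \<in> W (prod_encode (n, n)) k" using cover x by blast
    then obtain j where "y \<in> W (prod_encode (n, n)) j"
      using le unfolding first_index_le_def by blast
    then show ?thesis by (auto simp: W_def ok_def split: if_splits)
  qed
  have qm: "quasi_metric_on (topspace X) (index_dist W)"
  proof (rule quasi_metric_on_index_dist, rule ccontr)
    fix x y assume xy: "x \<in> topspace X" "y \<in> topspace X" "x \<noteq> y"
      "\<And>n. first_index_le (W n) x y" "\<And>n. first_index_le (W n) y x"
    then obtain U where "openin X U" "x \<in> U \<longleftrightarrow> y \<notin> U"
      using t0 unfolding t0_space_def by blast
    then obtain n where "x \<in> B n \<longleftrightarrow> y \<notin> B n"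
      using bB[of U x] bB[of U y] by blast
    then show False using le_B xy by blast
  qed
  have "\<exists>n. \<forall>y\<in>topspace X. first_index_le (W n) x y \<longrightarrow> y \<in> U" if "openin X U" "x \<in> U" for U x
    using bB[OF that] le_B by blast
  then have top: "X = qmetric_topology (topspace X) (index_dist W)"
    using qmetric_topology_index_dist[OF qm oW] by blast
  have "\<exists>y\<in>topspace X. (\<lambda>n. max (index_dist W (x n) y) (index_dist W y (x n))) \<longlonglongrightarrow> 0"
    if xX: "range x \<subseteq> topspace X"
      and cauchy: "\<forall>e>0. \<exists>N. \<forall>n\<ge>N. \<forall>p\<ge>n. index_dist W (x n) (x p) < e" for x :: "nat \<Rightarrow> 'a"
  proof -
    have mono: "\<exists>N. \<forall>p q. N \<le> p \<longrightarrow> p \<le> q \<longrightarrow> first_index_le (W n) (x p) (x q)" for n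
    proof -
      obtain N where N: "\<And>p q. N \<le> p \<Longrightarrow> p \<le> q \<Longrightarrow> index_dist W (x p) (x q) < 1 / real (Suc n)"
        using cauchy[rule_format, of "1 / real (Suc n)"] by (auto simp del: of_nat_Suc)
      then have "first_index_le (W n) (x p) (x q)" if "N \<le> p" "p \<le> q" for p q
        using that index_dist_less_iff[of W "x p" "x q" n] by blast
      then show ?thesis by blast
    qed
    \<comment> \<open>These indices will turn out to be those of the basic neighbourhoods of the
      limit.\<close>
    define F where "F = {m. \<forall>\<^sub>F p in sequentially. x p \<in> B m}"
    have "x p \<in> B 0" for p using xX B0 by blast
    then have F_0: "0 \<in> F" by (simp add: F_def)
    \<comment> \<open>The threshold on \<open>p\<close> is uniform in \<open>k\<close>, and keeping
      \<open>j\<close> at most \<open>k\<close> is what later compares \<open>x p\<close> with the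
      limit.\<close>
    have settle: "\<forall>\<^sub>F p in sequentially. \<forall>k. x p \<in> W n k \<longrightarrow> (\<exists>j\<le>k. j \<in> F \<and> ok n j)" for n
    proof -
      obtain N where "\<And>p q. N \<le> p \<Longrightarrow> p \<le> q \<Longrightarrow> first_index_le (W n) (x p) (x q)"
        using mono by blast
      then have ev: "\<exists>j\<le>k. \<forall>\<^sub>F q in sequentially. x q \<in> W n j" if "N \<le> p" "x p \<in> W n k" for p k
        using that by (rule first_index_le_Cauchy)
      have W_F: "j \<in> F \<and> ok n j" if "\<forall>\<^sub>F q in sequentially. x q \<in> W n j" for j
        using that by (cases "ok n j") (simp_all add: W_def F_def)
      have "\<forall>k. x p \<in> W n k \<longrightarrow> (\<exists>j\<le>k. j \<in> F \<and> ok n j)" if "N \<le> p" for p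
        using ev[OF that] W_F by meson
      then show ?thesis by (rule eventually_sequentiallyI)
    qed
    have refine: "\<exists>k\<in>F. R (B n) (B k) \<and> B k \<subseteq> B m" if "n \<in> F" "m \<in> F" for n m
    proof -
      have "\<forall>\<^sub>F p in sequentially. x p \<in> B n" "\<forall>\<^sub>F p in sequentially. x p \<in> B m"
        using that by (simp_all add: F_def)
      with settle[of "prod_encode (n, m)"]
      have "\<forall>\<^sub>F p in sequentially. \<exists>j. j \<in> F \<and> ok (prod_encode (n, m)) j"
        by eventually_elim (use cover in blast)
      then show ?thesis by (auto simp: ok_def)
    qed
    have "\<exists>s. \<forall>i. s i \<in> F \<and> (R (B (s i)) (B (s (Suc i))) \<and> (i \<in> F \<longrightarrow> B (s (Suc i)) \<subseteq> B i))"
    \<comment> \<open>Step \<open>i\<close> also shrinks into \<open>B i\<close> whenever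
      \<open>i\<close> is in \<open>F\<close>, so the point of the chain lies in every such
      \<open>B i\<close>.\<close>
    proof (rule dependent_nat_choice)
      show "\<exists>n. n \<in> F" using F_0 by (rule exI)
      fix n i assume "n \<in> F"
      then show "\<exists>k. k \<in> F \<and> R (B n) (B k) \<and> (i \<in> F \<longrightarrow> B k \<subseteq> B i)"
        using refine[of n i] refine[OF _ F_0, of n] by (cases "i \<in> F") auto
    qed
    then obtain s where s: "\<forall>i. s i \<in> F \<and> (R (B (s i)) (B (s (Suc i))) \<and>
        (i \<in> F \<longrightarrow> B (s (Suc i)) \<subseteq> B i))"
      by (rule exE)
    have "\<exists>y\<in>topspace X. (\<forall>i. y \<in> B (s i)) \<and>
        (\<forall>V. openin X V \<and> y \<in> V \<longrightarrow> (\<exists>i. B (s i) \<subseteq> V))"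
      using R_conv[rule_format, of "\<lambda>i. B (s i)"] s by simp
    then obtain y where y: "y \<in> topspace X" "\<forall>i. y \<in> B (s i)"
      "\<forall>V. openin X V \<and> y \<in> V \<longrightarrow> (\<exists>i. B (s i) \<subseteq> V)"
      by blast
    have F_iff: "m \<in> F \<longleftrightarrow> y \<in> B m" for m
    proof
      assume "m \<in> F"
      then have "B (s (Suc m)) \<subseteq> B m" using s by blast
      then show "y \<in> B m" using y(2) by blast
    next
      assume "y \<in> B m"
      then obtain i where i: "B (s i) \<subseteq> B m" using y(3) oB by blast
      have "\<forall>\<^sub>F p in sequentially. x p \<in> B (s i)" using s by (simp add: F_def)
      then show "m \<in> F"
        unfolding F_def mem_Collect_eq by eventually_elim (use i in blast)
    qed
    \<comment> \<open>With \<open>settle\<close>, any index of \<open>x p\<close> is bounded below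
      by an index of \<open>y\<close>, which gives the comparison from \<open>x p\<close> to
      \<open>y\<close>.\<close>
    have y_W: "y \<in> W n j" if "j \<in> F" "ok n j" for n j
      using that by (simp add: W_def F_iff)
    have "\<forall>\<^sub>F p in sequentially. first_index_le (W n) (x p) y" for n
      using settle[of n]
      by eventually_elim (use y_W in \<open>unfold first_index_le_def, blast\<close>)
    then have to: "\<forall>\<^sub>F p in sequentially. index_dist W (x p) y < e" if "e > 0" for e
      using that by (rule index_dist_eventually_less)
    have "\<forall>\<^sub>F z in filtermap x sequentially. first_index_le (W n) y z" for n
    \<comment> \<open>For the reverse comparison, a set \<open>W n k\<close> containing
      \<open>y\<close> has \<open>k\<close> in \<open>F\<close>, so the sequence eventually lies in
      it.\<close>
    proof (rule first_index_le_eventually)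
      fix k assume "y \<in> W n k"
      then have "ok n k" "k \<in> F" by (auto simp: W_def F_iff split: if_splits)
      then show "\<forall>\<^sub>F z in filtermap x sequentially. z \<in> W n k"
        by (simp add: W_def F_def eventually_filtermap)
    qed
    then have "\<forall>\<^sub>F p in sequentially. first_index_le (W n) y (x p)" for n
      by (simp add: eventually_filtermap)
    then have from_y: "\<forall>\<^sub>F p in sequentially. index_dist W y (x p) < e" if "e > 0" for e
      using that by (rule index_dist_eventually_less)
    have "(\<lambda>n. max (index_dist W (x n) y) (index_dist W y (x n))) \<longlonglongrightarrow> 0"
    proof (rule tendstoI)
      fix e :: real assume "e > 0"
      show "\<forall>\<^sub>F n in sequentially.
          dist (max (index_dist W (x n) y) (index_dist W y (x n))) 0 < e"
        using to[OF \<open>e > 0\<close>] from_y[OF \<open>e > 0\<close>]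
        by eventually_elim (simp add: index_dist_nonneg le_max_iff_disj)
    qed
    then show ?thesis using y(1) by blast
  qed
  then have "quasi_metric_complete (topspace X) (index_dist W)"
    unfolding quasi_metric_complete_def by blast
  then show ?thesis unfolding quasi_Polish_def using sc qm top by blast
qed

theorem theorem3p11:
  fixes X :: "'a topology"
  shows "quasi_Polish X \<longleftrightarrow>
           t0_space X \<and> convergent_approximation_space X \<and> second_countable X"
proof
  assume X: "quasi_Polish X"
  then obtain d where "quasi_metric_on (topspace X) d" "X = qmetric_topology (topspace X) d"
    unfolding quasi_Polish_def by blast
  then have "t0_space X" using t0_space_qmetric_topology by metis
  with X show "t0_space X \<and> convergent_approximation_space X \<and> second_countable X"
    using quasi_Polish_imp_convergent_approximation_space unfolding quasi_Polish_def by blast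
qed (use convergent_approximation_space_imp_quasi_Polish in blast)

end
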